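(* Let $f=h+\overline{g}$ be an orientation preserving harmonic mapping in the unit disk $\mathbb{D}$ with dilatation $\omega=g'/h'$. If \[ \limsup_{|z|\to 1}\left(|P_H(f)(z)|\,(1-|z|^2)+\frac{|\omega'(z)|\,(1-|z|^2)}{1-|\omega(z)|^2}\right)<1, \] then there exists a positive integer $N$ such that $f$ takes every value at most $N$ times in $\mathbb{D}$.
   Context: $\mathbb{D}=\{z\in\mathbb{C}:|z|<1\}$. A complex-valued harmonic function $f$ in $\mathbb{D}$ is written in its canonical representation $f=h+\overline{g}$, with $h,g$ analytic in $\mathbb{D}$ and $g(0)=0$. An orientation preserving harmonic mapping in $\mathbb{D}$ is a locally univalent harmonic function $f=h+\overline g$ whose Jacobian $J_f=|h'|^2-|g'|^2$ is positive throughout $\mathbb{D}$; then $h'$ has no zeros in $\mathbb{D}$ and the dilatation $\omega=g'/h'$ is analytic in $\mathbb{D}$ with $|\omega(z)|<1$ for all $z\in\mathbb{D}$. The harmonic pre-Schwarzian derivative of $f$ is \[ P_H(f)=P(h)-\frac{\overline{\omega}\,\omega'}{1-|\omega|^2},\qquad P(h)=\frac{h''}{h'}. \] "$f$ takes every value at most $N$ times in $\mathbb{D}$" means that $n(f,w)\le N$ for every $w\in\mathbb{C}$, where $n(f,w)$ is the number of points $z\in\mathbb{D}$ (counting multiplicities) with $f(z)=w$. *)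

theory Defs
  imports "HOL-Complex_Analysis.Complex_Analysis"
begin

abbreviation unit_disk :: "complex set" where
  "unit_disk \<equiv> ball 0 1"

text \<open>Complex-valued harmonic functions: twice continuously differentiable in the real sense,
  with vanishing Laplacian. Here \<open>fx\<close>, \<open>fy\<close> are the first-order and \<open>fxx\<close>, \<open>fxy\<close>, \<open>fyx\<close>, \<open>fyy\<close>
  the second-order partial derivatives with respect to \<open>z = x + i y\<close>.\<close>

definition harmonic_on :: "(complex \<Rightarrow> complex) \<Rightarrow> complex set \<Rightarrow> bool" where
  "harmonic_on f S \<longleftrightarrow>
     (\<exists>fx fy fxx fxy fyx fyy.
        (\<forall>z\<in>S. (f has_derivative (\<lambda>v. Re v *\<^sub>R fx z + Im v *\<^sub>R fy z)) (at z)) \<and>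
        (\<forall>z\<in>S. (fx has_derivative (\<lambda>v. Re v *\<^sub>R fxx z + Im v *\<^sub>R fxy z)) (at z)) \<and>
        (\<forall>z\<in>S. (fy has_derivative (\<lambda>v. Re v *\<^sub>R fyx z + Im v *\<^sub>R fyy z)) (at z)) \<and>
        continuous_on S fxx \<and> continuous_on S fxy \<and>
        continuous_on S fyx \<and> continuous_on S fyy \<and>
        (\<forall>z\<in>S. fxx z + fyy z = 0))"

definition canonical_rep ::
  "(complex \<Rightarrow> complex) \<Rightarrow> (complex \<Rightarrow> complex) \<Rightarrow> (complex \<Rightarrow> complex) \<Rightarrow> bool" where
  "canonical_rep f h g \<longleftrightarrow>
     h holomorphic_on unit_disk \<and> g holomorphic_on unit_disk \<and> g 0 = 0 \<and>
     (\<forall>z\<in>unit_disk. f z = h z + cnj (g z))"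

definition locally_univalent_on :: "(complex \<Rightarrow> complex) \<Rightarrow> complex set \<Rightarrow> bool" where
  "locally_univalent_on f S \<longleftrightarrow>
     (\<forall>z\<in>S. \<exists>U. open U \<and> z \<in> U \<and> U \<subseteq> S \<and> inj_on f U)"

definition jacobian :: "(complex \<Rightarrow> complex) \<Rightarrow> (complex \<Rightarrow> complex) \<Rightarrow> complex \<Rightarrow> real" where
  "jacobian h g z = (cmod (deriv h z))\<^sup>2 - (cmod (deriv g z))\<^sup>2"

definition orientation_preserving_harmonic_mapping ::
  "(complex \<Rightarrow> complex) \<Rightarrow> (complex \<Rightarrow> complex) \<Rightarrow> (complex \<Rightarrow> complex) \<Rightarrow> bool" where
  "orientation_preserving_harmonic_mapping f h g \<longleftrightarrow>
     harmonic_on f unit_disk \<and> canonical_rep f h g \<and> locally_univalent_on f unit_disk \<and>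
     (\<forall>z\<in>unit_disk. jacobian h g z > 0)"

definition dilatation :: "(complex \<Rightarrow> complex) \<Rightarrow> (complex \<Rightarrow> complex) \<Rightarrow> complex \<Rightarrow> complex" where
  "dilatation h g z = deriv g z / deriv h z"

definition pre_Schwarzian :: "(complex \<Rightarrow> complex) \<Rightarrow> complex \<Rightarrow> complex" where
  "pre_Schwarzian h z = deriv (deriv h) z / deriv h z"

definition harmonic_pre_Schwarzian ::
  "(complex \<Rightarrow> complex) \<Rightarrow> (complex \<Rightarrow> complex) \<Rightarrow> complex \<Rightarrow> complex" where
  "harmonic_pre_Schwarzian h g z =
     pre_Schwarzian h z -
     cnj (dilatation h g z) * deriv (dilatation h g) z /
       of_real (1 - (cmod (dilatation h g z))\<^sup>2)"

text \<open>The filter \<open>|z| \<rightarrow> 1\<close> inside the disk: it is generated by the annuli \<open>r < |z| < 1\<close>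
  with \<open>r < 1\<close>.\<close>

abbreviation to_unit_circle :: "complex filter" where
  "to_unit_circle \<equiv> filtercomap cmod (at_left 1)"

text \<open>The multiplicity of \<open>f = h + cnj g\<close> at \<open>z\<close> is the order of vanishing of \<open>f - f z\<close> at \<open>z\<close>,
  i.e. the smallest positive degree in which the Taylor expansion of \<open>h\<close> or of \<open>g\<close> about \<open>z\<close>
  has a nonzero coefficient.\<close>

definition harmonic_multiplicity ::
  "(complex \<Rightarrow> complex) \<Rightarrow> (complex \<Rightarrow> complex) \<Rightarrow> complex \<Rightarrow> nat" where
  "harmonic_multiplicity h g z =
     (LEAST n. n > 0 \<and> ((deriv ^^ n) h z \<noteq> 0 \<or> (deriv ^^ n) g z \<noteq> 0))"

text \<open>The number \<open>n(f, w)\<close> of solutions of \<open>f z = w\<close> in the disk, with multiplicities. All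
  multiplicities are positive for non-constant \<open>f\<close>, so an infinite fibre counts as \<open>\<infinity>\<close>.\<close>

definition valence ::
  "(complex \<Rightarrow> complex) \<Rightarrow> (complex \<Rightarrow> complex) \<Rightarrow> (complex \<Rightarrow> complex) \<Rightarrow> complex \<Rightarrow> enat" where
  "valence f h g w =
     (let A = {z \<in> unit_disk. f z = w}
      in if finite A then enat (\<Sum>z\<in>A. harmonic_multiplicity h g z) else \<infinity>)"

end

theory Submission
  imports Defs
begin

text \<open>
  Why the theorem holds. For \<open>|a| \<le> 1\<close> put \<open>F = h + a g\<close>. A computation gives
  \<open>|F''/F'| \<le> |P_H(f)| + |\<omega>'| / (1 - |\<omega>|\<^sup>2)\<close>, whatever \<open>a\<close> is; this is
  \<open>pencil_pre_Schwarzian_bound\<close>. By hypothesis there is thus an annulus \<open>r0 < |z| < 1\<close> on which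
  \<open>(1 - |z|\<^sup>2) |F''/F'| < 1\<close> for all these \<open>a\<close> simultaneously. Becker's univalence criterion asks
  for such an inequality in the whole disk; what is needed here is a local version of it, in which
  the size of the region of univalence depends on \<open>r0\<close> only, and not on \<open>a\<close>.

  The local criterion is \<open>inj_on_lens\<close>. The region is the lens \<open>K\<close> in which the closed unit disk
  meets the closed disk of radius \<open>1 - |p|\<^sup>2\<close> about a point \<open>p\<close>. When \<open>|p|\<close> is close to 1, this
  disk reaches across the unit circle near \<open>p/|p|\<close> and avoids \<open>|z| \<le> r0\<close>. Let \<open>R\<close> be the map of
  the plane onto \<open>K\<close> that reflects first in the unit circle and then in the other circle, each time
  only the points outside the circle. As in the Ahlfors--Becker extension, consider
  \<open>\<Phi>(w) = F(R w) + (w - R w) F'(R w)\<close>, which equals \<open>F\<close> on \<open>K\<close>. The local Lipschitz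
  constant of \<open>R\<close> at \<open>w\<close> is at most \<open>(1 - |R w|\<^sup>2) / |w - R w|\<close>
  (\<open>lens_fold_contraction\<close> and \<open>lens_fold_displacement\<close>), which is exactly what makes \<open>\<Phi>\<close> locally
  injective. Moreover \<open>\<Phi>\<close> is proper and it is injective near infinity, so that it is injective
  (\<open>proper_locally_injective_imp_inj\<close>), and then \<open>F\<close> is injective on \<open>K\<close>. The regularity on the
  boundary that this requires is gained by passing to \<open>F(r z)\<close> with \<open>r < 1\<close>
  (\<open>inj_on_disk_inter_ball\<close>).

  If \<open>f x = f y\<close>, then \<open>h + a g\<close> takes the same value at \<open>x\<close> and \<open>y\<close> for a suitable \<open>a\<close> with
  \<open>|a| \<le> 1\<close>. Hence \<open>f\<close> is injective in the part of the unit disk near each boundary point; near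
  interior points it is locally univalent. By compactness finitely many sets on which \<open>f\<close> is
  injective cover the disk, and their number bounds the number of solutions of \<open>f z = w\<close>. All
  multiplicities are 1, because \<open>h'\<close> has no zeros.
\<close>

section \<open>Proper locally injective maps\<close>

text \<open>
  A monodromy argument: the set of values that are taken more than once is open, by invariance of
  domain applied near two distinct preimages, and closed, because properness gives limits of
  pairs of preimages and local injectivity keeps those limits apart. It is not the whole space,
  as values of large norm are taken only outside the ball \<open>cball 0 T\<close>; so it is empty.
\<close>

lemma proper_locally_injective_imp_inj:
  fixes f :: "'a::euclidean_space \<Rightarrow> 'a"
  assumes cont: "continuous_on UNIV f"
    and loc: "\<And>x. \<exists>e>0. inj_on f (ball x e)"
    and proper: "\<And>B. bounded {x. norm (f x) \<le> B}"
    and far: "inj_on f (- cball 0 T)"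
  shows "inj f"
proof (rule ccontr)
  assume "\<not> inj f"
  define A where "A = {v. \<exists>a b. a \<noteq> b \<and> f a = v \<and> f b = v}"
  have op: "open (f ` ball x e)" if "inj_on f (ball x e)" for x e
    by (rule invariance_of_domain[OF continuous_on_subset[OF cont] open_ball that]) auto
  have "open A"
  proof (subst open_subopen, intro ballI)
    fix v assume "v \<in> A"
    then obtain a b where ab: "a \<noteq> b" "f a = v" "f b = v" by (auto simp: A_def)
    obtain e1 e2 where e: "e1 > 0" "inj_on f (ball a e1)" "e2 > 0" "inj_on f (ball b e2)"
      using loc by metis
    define d where "d = Min {e1, e2, dist a b / 2}"
    have d: "d > 0" "d \<le> e1" "d \<le> e2" "2 * d \<le> dist a b"
      using e ab by (auto simp: d_def min_def)
    have "inj_on f (ball a d)" "inj_on f (ball b d)"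
      using inj_on_subset[OF e(2)] inj_on_subset[OF e(4)] d by (simp_all add: subset_ball)
    hence "open (f ` ball a d)" "open (f ` ball b d)" by (auto intro: op)
    hence o: "open (f ` ball a d \<inter> f ` ball b d)" by blast
    have disj: "ball a d \<inter> ball b d = {}"
      using d by (intro disjoint_ballI) auto
    have "f ` ball a d \<inter> f ` ball b d \<subseteq> A"
    proof
      fix u assume "u \<in> f ` ball a d \<inter> f ` ball b d"
      then obtain x y where xy: "x \<in> ball a d" "f x = u" "y \<in> ball b d" "f y = u"
        by (elim IntE imageE) simp
      have "x \<noteq> y" using xy(1,3) disj by (simp only: disjoint_iff) metis
      with xy(2,4) show "u \<in> A" unfolding A_def by blast
    qed
    moreover have "v \<in> f ` ball a d \<inter> f ` ball b d"
      using ab d by (intro IntI image_eqI[where x=a] image_eqI[where x=b]) auto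
    ultimately show "\<exists>T. open T \<and> v \<in> T \<and> T \<subseteq> A" using o by blast
  qed
  moreover have "closed A"
    unfolding closed_sequential_limits
  proof (intro allI impI, elim conjE)
    fix v l assume vA: "\<forall>n. v n \<in> A" and lim: "v \<longlonglongrightarrow> l"
    obtain a b where ab: "\<And>n. a n \<noteq> b n" "\<And>n. f (a n) = v n" "\<And>n. f (b n) = v n"
      using vA unfolding A_def mem_Collect_eq by metis
    obtain B where B: "\<And>n. norm (v n) \<le> B"
      using convergent_imp_bounded[OF lim] by (auto simp: bounded_iff)
    define X where "X = closure {x. norm (f x) \<le> B}"
    have compX: "compact (X \<times> X)"
      unfolding X_def using proper by (intro compact_Times) (auto simp: compact_closure)
    have "x \<in> X" if "norm (f x) \<le> B" for x
      unfolding X_def by (rule subsetD[OF closure_subset]) (simp add: that)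
    hence "(a n, b n) \<in> X \<times> X" for n using B ab by simp
    then obtain q s where qs: "strict_mono (s :: nat \<Rightarrow> nat)" "((\<lambda>n. (a n, b n)) \<circ> s) \<longlonglongrightarrow> q"
      using seq_compactE[OF compact_imp_seq_compact[OF compX], of "\<lambda>n. (a n, b n)"] by metis
    obtain x y where q: "q = (x, y)" by (cases q)
    have la: "(\<lambda>n. a (s n)) \<longlonglongrightarrow> x" and lb: "(\<lambda>n. b (s n)) \<longlonglongrightarrow> y"
      using tendsto_fst[OF qs(2)] tendsto_snd[OF qs(2)] by (auto simp: q o_def)
    have lv: "(\<lambda>n. v (s n)) \<longlonglongrightarrow> l" using LIMSEQ_subseq_LIMSEQ[OF lim qs(1)] by (simp add: o_def)
    have ic: "isCont f z" for z using cont by (simp add: continuous_on_eq_continuous_at)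
    have fx: "f x = l"
      using isCont_tendsto_compose[OF ic la] lv ab(2) LIMSEQ_unique by auto
    have fy: "f y = l"
      using isCont_tendsto_compose[OF ic lb] lv ab(3) LIMSEQ_unique by auto
    have "x \<noteq> y"
    proof
      assume "x = y"
      obtain e where e: "e > 0" "inj_on f (ball x e)" using loc by blast
      have "eventually (\<lambda>n. a (s n) \<in> ball x e) sequentially"
        using tendstoD[OF la \<open>e > 0\<close>] by (auto elim: eventually_mono simp: dist_commute)
      moreover have "eventually (\<lambda>n. b (s n) \<in> ball x e) sequentially"
        using tendstoD[OF lb \<open>e > 0\<close>] \<open>x = y\<close> by (auto elim: eventually_mono simp: dist_commute)
      ultimately have "eventually (\<lambda>n. False) sequentially"
        by eventually_elim (metis ab e(2) inj_onD)
      thus False by simp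
    qed
    thus "l \<in> A" using fx fy by (auto simp: A_def)
  qed
  moreover have "A \<noteq> {}" using \<open>\<not> inj f\<close> unfolding A_def inj_def by blast
  ultimately have "A = UNIV" using clopen[of A] by auto
  have "compact (f ` cball 0 T)"
    by (rule compact_continuous_image[OF continuous_on_subset[OF cont]]) auto
  then obtain B where B: "\<And>x. x \<in> cball 0 T \<Longrightarrow> norm (f x) \<le> B"
    using compact_imp_bounded by (force simp: bounded_iff)
  obtain v :: 'a where v: "norm v = \<bar>B\<bar> + 1" using vector_choose_size[of "\<bar>B\<bar> + 1"] by auto
  have "v \<in> A" using \<open>A = UNIV\<close> by simp
  then obtain a b where ab: "a \<noteq> b" "f a = v" "f b = v" unfolding A_def by blast
  have "a \<in> - cball 0 T" "b \<in> - cball 0 T" using B[of a] B[of b] ab v by auto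
  thus False using inj_onD[OF far, of a b] ab by simp
qed

section \<open>Reflecting the exterior of a ball into the ball\<close>

text \<open>
  The map \<open>ball_fold c r\<close> is the identity on \<open>cball c r\<close> and inversion in the sphere outside;
  its conformal scaling factor at \<open>w\<close> is the square of \<open>fold_factor c r w\<close>. The square root is the
  natural quantity because it enters separately from both points in \<open>ball_fold_contraction\<close>.
\<close>
definition fold_factor :: "'a::real_inner \<Rightarrow> real \<Rightarrow> 'a \<Rightarrow> real" where
  "fold_factor c r w = r / max r (norm (w - c))"

definition ball_fold :: "'a::real_inner \<Rightarrow> real \<Rightarrow> 'a \<Rightarrow> 'a" where
  "ball_fold c r w = c + (fold_factor c r w)\<^sup>2 *\<^sub>R (w - c)"

lemma fold_factor_bounds:
  assumes "r > 0"
  shows "fold_factor c r w > 0" "fold_factor c r w \<le> 1"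
    "fold_factor c r w * norm (w - c) \<le> r"
proof -
  have m: "max r (norm (w - c)) > 0" using assms by linarith
  show "fold_factor c r w > 0" "fold_factor c r w \<le> 1"
    using assms m by (simp_all add: fold_factor_def)
  show "fold_factor c r w * norm (w - c) \<le> r"
    using assms m by (simp add: fold_factor_def pos_divide_le_eq mult_left_mono)
qed

lemma continuous_on_fold_factor: "r > 0 \<Longrightarrow> continuous_on S (fold_factor c r)"
  unfolding fold_factor_def by (intro continuous_intros) (auto simp: max_def)

lemma continuous_on_ball_fold: "r > 0 \<Longrightarrow> continuous_on S (ball_fold c r)"
  unfolding ball_fold_def by (intro continuous_intros continuous_on_fold_factor)

lemma ball_fold_id: "r > 0 \<Longrightarrow> w \<in> cball c r \<Longrightarrow> ball_fold c r w = w"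
  by (auto simp: ball_fold_def fold_factor_def dist_norm norm_minus_commute max_def)

lemma ball_fold_in_convex:
  assumes "r > 0" "convex S" "c \<in> S" "w \<in> S"
  shows "ball_fold c r w \<in> S"
proof -
  have "(fold_factor c r w)\<^sup>2 \<le> 1"
    using fold_factor_bounds[OF assms(1), of c w] by (simp add: power_le_one)
  hence "(1 - (fold_factor c r w)\<^sup>2) *\<^sub>R c + (fold_factor c r w)\<^sup>2 *\<^sub>R w \<in> S"
    using assms by (intro convexD) auto
  thus ?thesis by (simp add: ball_fold_def algebra_simps)
qed

lemma ball_fold_in_cball:
  assumes "r > 0"
  shows "ball_fold c r w \<in> cball c r"
proof -
  have "(fold_factor c r w)\<^sup>2 * norm (w - c) = fold_factor c r w * (fold_factor c r w * norm (w - c))"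
    by (simp add: power2_eq_square)
  also have "\<dots> \<le> 1 * r"
    using fold_factor_bounds[OF assms, of c w] assms by (intro mult_mono) auto
  finally show ?thesis by (simp add: ball_fold_def dist_norm)
qed

text \<open>
  For two points outside the ball this is the equality that holds for inversions, and for two points
  inside it is trivial. The computation below treats these and the mixed case together: with \<open>u\<close>,
  \<open>v\<close> the positions relative to the centre and \<open>m\<close>, \<open>n\<close> the factors, the difference of the squares
  of both sides is \<open>(m\<^sup>2 - n\<^sup>2) (m\<^sup>2|u|\<^sup>2 - n\<^sup>2|v|\<^sup>2)\<close>, and \<open>m\<close> decreases with \<open>|u|\<close> while \<open>m |u|\<close>
  increases.
\<close>
lemma ball_fold_contraction:
  assumes "r > 0"
  shows "norm (ball_fold c r a - ball_fold c r b)
           \<le> fold_factor c r a * fold_factor c r b * norm (a - b)"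
proof -
  define u v m n where uv: "u = a - c" "v = b - c"
    and mn: "m = fold_factor c r a" "n = fold_factor c r b"
  note mb = fold_factor_bounds[OF assms, of c a, folded mn uv]
  note nb = fold_factor_bounds[OF assms, of c b, folded mn uv]
  have key: "(m\<^sup>2 - n\<^sup>2) * ((m * norm u)\<^sup>2 - (n * norm v)\<^sup>2) \<le> 0"
  proof -
    have mono: "fold_factor c r y \<le> fold_factor c r x \<and>
        fold_factor c r x * norm (x - c) \<le> fold_factor c r y * norm (y - c)"
      if "norm (x - c) \<le> norm (y - c)" for x y
    proof -
      have pos: "max r (norm (x - c)) > 0" "max r (norm (y - c)) > 0" using assms by linarith+
      have "norm (x - c) * max r (norm (y - c)) \<le> norm (y - c) * max r (norm (x - c))"
        using that assms by (auto simp: max_def mult.commute intro: mult_right_mono)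
      hence "norm (x - c) / max r (norm (x - c)) \<le> norm (y - c) / max r (norm (y - c))"
        using pos by (simp add: divide_simps)
      moreover have "1 / max r (norm (y - c)) \<le> 1 / max r (norm (x - c))"
        using that pos by (intro divide_left_mono mult_pos_pos) auto
      ultimately have "r * (1 / max r (norm (y - c))) \<le> r * (1 / max r (norm (x - c)))"
        "r * (norm (x - c) / max r (norm (x - c))) \<le> r * (norm (y - c) / max r (norm (y - c)))"
        using assms by (intro mult_left_mono; simp)+
      thus ?thesis by (simp add: fold_factor_def)
    qed
    consider "norm u \<le> norm v" | "norm v \<le> norm u" by linarith
    thus ?thesis
    proof cases
      case 1
      hence "n \<le> m" "m * norm u \<le> n * norm v" using mono[of a b] by (auto simp: uv mn)
      thus ?thesis using mb nb by (intro mult_nonneg_nonpos) (auto intro!: power_mono)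
    next
      case 2
      hence "m \<le> n" "n * norm v \<le> m * norm u" using mono[of b a] by (auto simp: uv mn)
      thus ?thesis using mb nb by (intro mult_nonpos_nonneg) (auto intro!: power_mono)
    qed
  qed
  have norm_diff: "(norm (x - y))\<^sup>2 = (norm x)\<^sup>2 + (norm y)\<^sup>2 - 2 * (x \<bullet> y)" for x y :: 'a
    by (simp add: power2_norm_eq_inner inner_diff_left inner_diff_right inner_commute)
  have "(norm (m\<^sup>2 *\<^sub>R u - n\<^sup>2 *\<^sub>R v))\<^sup>2 - (m * n * norm (u - v))\<^sup>2
      = (m\<^sup>2 - n\<^sup>2) * ((m * norm u)\<^sup>2 - (n * norm v)\<^sup>2)"
    by (simp add: norm_diff power_mult_distrib algebra_simps)
  hence "(norm (m\<^sup>2 *\<^sub>R u - n\<^sup>2 *\<^sub>R v))\<^sup>2 \<le> (m * n * norm (u - v))\<^sup>2" using key by linarith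
  moreover have "0 \<le> m * n * norm (u - v)" using mb(1) nb(1) by simp
  ultimately have "norm (m\<^sup>2 *\<^sub>R u - n\<^sup>2 *\<^sub>R v) \<le> m * n * norm (u - v)"
    by (rule power2_le_imp_le)
  thus ?thesis by (simp add: ball_fold_def uv mn)
qed

section \<open>Folding the plane onto a lens\<close>

text \<open>
  The order of the two reflections matters: the second one moves points towards \<open>p\<close>, which lies in
  the unit disk, so it does not leave the unit disk again.
\<close>
definition lens_fold :: "complex \<Rightarrow> complex \<Rightarrow> complex" where
  "lens_fold p w = ball_fold p (1 - (cmod p)\<^sup>2) (ball_fold 0 1 w)"

definition lens_factor :: "complex \<Rightarrow> complex \<Rightarrow> real" where
  "lens_factor p w = fold_factor p (1 - (cmod p)\<^sup>2) (ball_fold 0 1 w) * fold_factor 0 1 w"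

abbreviation lens :: "complex \<Rightarrow> complex set" where
  "lens p \<equiv> cball 0 1 \<inter> cball p (1 - (cmod p)\<^sup>2)"

context
  fixes p :: complex
  assumes p: "cmod p < 1"
begin

lemma lens_radius_pos: "1 - (cmod p)\<^sup>2 > 0"
  using p by (simp add: abs_square_less_1)

lemma continuous_on_lens_fold: "continuous_on S (lens_fold p)"
  unfolding lens_fold_def
  by (intro continuous_on_compose2[OF continuous_on_ball_fold[OF lens_radius_pos, of UNIV]]
      continuous_on_ball_fold) auto

lemma continuous_on_lens_factor: "continuous_on S (lens_factor p)"
  unfolding lens_factor_def
  by (intro continuous_intros continuous_on_compose2[OF continuous_on_fold_factor[OF lens_radius_pos, of UNIV]]
      continuous_on_ball_fold continuous_on_fold_factor) auto

lemma lens_fold_in_lens: "lens_fold p w \<in> lens p"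
proof -
  have "ball_fold p (1 - (cmod p)\<^sup>2) (ball_fold 0 1 w) \<in> cball 0 1"
    by (rule ball_fold_in_convex[OF lens_radius_pos]) (use p ball_fold_in_cball[of 1 0 w] in auto)
  thus ?thesis
    using ball_fold_in_cball[OF lens_radius_pos] unfolding lens_fold_def by blast
qed

lemma lens_fold_id: "w \<in> lens p \<Longrightarrow> lens_fold p w = w"
  using lens_radius_pos by (simp add: lens_fold_def ball_fold_id del: mem_cball)

lemma lens_factor_nonneg: "lens_factor p w \<ge> 0"
  unfolding lens_factor_def
  using fold_factor_bounds(1)[OF lens_radius_pos] fold_factor_bounds(1)[of 1 "0::complex"]
  by (intro mult_nonneg_nonneg less_imp_le) auto

text \<open>Together with \<open>lens_fold_contraction\<close> below this bounds the distance of the images of \<open>a\<close> and \<open>b\<close>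
  by \<open>|a - b| / (|a| |b|)\<close>: near infinity the folding is almost constant.\<close>
lemma lens_factor_le: "lens_factor p w * cmod w \<le> 1"
proof -
  have "lens_factor p w * cmod w =
      fold_factor p (1 - (cmod p)\<^sup>2) (ball_fold 0 1 w) * (fold_factor 0 1 w * cmod (w - 0))"
    by (simp add: lens_factor_def)
  also have "\<dots> \<le> 1 * 1"
    using fold_factor_bounds[OF lens_radius_pos, of p "ball_fold 0 1 w"]
      fold_factor_bounds[of 1 0 w]
    by (intro mult_mono) auto
  finally show ?thesis by simp
qed

lemma lens_fold_contraction:
  "cmod (lens_fold p a - lens_fold p b) \<le> lens_factor p a * lens_factor p b * cmod (a - b)"
proof -
  have "cmod (lens_fold p a - lens_fold p b) \<le>
     fold_factor p (1 - (cmod p)\<^sup>2) (ball_fold 0 1 a) * fold_factor p (1 - (cmod p)\<^sup>2) (ball_fold 0 1 b)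
       * cmod (ball_fold 0 1 a - ball_fold 0 1 b)"
    unfolding lens_fold_def by (rule ball_fold_contraction[OF lens_radius_pos])
  also have "\<dots> \<le> fold_factor p (1 - (cmod p)\<^sup>2) (ball_fold 0 1 a)
       * fold_factor p (1 - (cmod p)\<^sup>2) (ball_fold 0 1 b)
       * (fold_factor 0 1 a * fold_factor 0 1 b * cmod (a - b))"
    by (intro mult_left_mono ball_fold_contraction mult_nonneg_nonneg less_imp_le
        fold_factor_bounds(1)[OF lens_radius_pos]) auto
  finally show ?thesis by (simp add: lens_factor_def algebra_simps)
qed

text \<open>
  This inequality is what makes Becker's constant 1 suffice on the lens. With \<open>v\<close> the image of \<open>w\<close>
  under the reflection in the unit circle, the displacement is at most \<open>|w - v| + |v - z|\<close>. The first
  part is controlled by \<open>1 - |v|\<^sup>2\<close> and the second by the radius \<open>1 - |p|\<^sup>2\<close>; as \<open>z\<close> divides the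
  segment from \<open>p\<close> to \<open>v\<close> in the ratio \<open>\<tau> : 1 - \<tau>\<close>, the concave function \<open>1 - |z|\<^sup>2\<close> is at least the
  corresponding mean of \<open>1 - |v|\<^sup>2\<close> and \<open>1 - |p|\<^sup>2\<close>. The radius of the second disk was chosen to make
  these two estimates match.
\<close>
lemma lens_fold_displacement:
  "cmod (w - lens_fold p w) * (lens_factor p w)\<^sup>2 \<le> 1 - (cmod (lens_fold p w))\<^sup>2"
proof -
  define \<rho> where "\<rho> = 1 - (cmod p)\<^sup>2"
  define v where "v = ball_fold 0 1 w"
  define \<alpha> where "\<alpha> = (fold_factor 0 1 w)\<^sup>2"
  define \<tau> where "\<tau> = (fold_factor p \<rho> v)\<^sup>2"
  define z where "z = lens_fold p w"
  have \<rho>: "\<rho> > 0" using lens_radius_pos by (simp add: \<rho>_def)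
  have v: "v = \<alpha> *\<^sub>R w" by (simp add: v_def ball_fold_def \<alpha>_def)
  have z: "z = p + \<tau> *\<^sub>R (v - p)" by (simp add: z_def lens_fold_def ball_fold_def \<tau>_def v_def \<rho>_def)
  have \<alpha>: "0 \<le> \<alpha>" "\<alpha> \<le> 1"
    using fold_factor_bounds[of 1 0 w] by (auto simp: \<alpha>_def power_le_one)
  have \<tau>: "0 \<le> \<tau>" "\<tau> \<le> 1"
    using fold_factor_bounds[OF \<rho>, of p v] by (auto simp: \<tau>_def power_le_one)
  have v1: "cmod v \<le> 1" using ball_fold_in_cball[of 1 0 w] by (simp add: v_def)
  have "z - p = \<tau> *\<^sub>R (v - p)" by (simp add: z)
  moreover have "cmod (z - p) \<le> \<rho>"
    using lens_fold_in_lens[of w] by (simp add: z_def \<rho>_def dist_norm norm_minus_commute)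
  ultimately have tp: "\<tau> * cmod (v - p) \<le> \<rho>" using \<tau> by simp
  have wv: "\<alpha> * cmod (w - v) \<le> 1 - (cmod v)\<^sup>2"
  proof (cases "cmod w \<le> 1")
    case True
    hence "\<alpha> = 1" by (simp add: \<alpha>_def fold_factor_def)
    thus ?thesis using v1 by (simp add: v power_le_one)
  next
    case False
    hence a: "\<alpha> = 1 / (cmod w)\<^sup>2" by (simp add: \<alpha>_def fold_factor_def power_divide)
    have nv: "cmod v = \<alpha> * cmod w" using \<alpha> by (simp add: v)
    have v2: "(cmod v)\<^sup>2 = \<alpha>" using False by (simp add: nv a power_mult_distrib field_simps power2_eq_square)
    have "w - v = (1 - \<alpha>) *\<^sub>R w" by (simp add: v algebra_simps)
    hence "\<alpha> * cmod (w - v) = (1 - \<alpha>) * cmod v" using \<alpha> by (simp add: nv)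
    also have "\<dots> \<le> (1 - \<alpha>) * 1" using \<alpha> v1 by (intro mult_left_mono) auto
    finally show ?thesis by (simp add: v2)
  qed
  have "v - z = (1 - \<tau>) *\<^sub>R (v - p)" by (simp add: z algebra_simps)
  hence vz: "cmod (v - z) = (1 - \<tau>) * cmod (v - p)" using \<tau> by simp
  have "cmod (w - z) * (\<tau> * \<alpha>) \<le> (cmod (w - v) + cmod (v - z)) * (\<tau> * \<alpha>)"
    using \<alpha> \<tau> norm_triangle_ineq[of "w - v" "v - z"] by (intro mult_right_mono) auto
  also have "\<dots> = \<tau> * (\<alpha> * cmod (w - v)) + \<alpha> * ((1 - \<tau>) * (\<tau> * cmod (v - p)))"
    by (simp add: vz algebra_simps)
  also have "\<dots> \<le> \<tau> * (1 - (cmod v)\<^sup>2) + 1 * ((1 - \<tau>) * \<rho>)"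
    using wv tp \<alpha> \<tau> \<rho> by (intro add_mono mult_mono) auto
  also have "\<dots> \<le> \<tau> * (1 - (cmod v)\<^sup>2) + (1 - \<tau>) * \<rho> + \<tau> * (1 - \<tau>) * (cmod (v - p))\<^sup>2"
    using \<tau> by simp
  also have "\<dots> = 1 - (cmod z)\<^sup>2"
    unfolding z \<rho>_def cmod_power2 by (simp add: algebra_simps power2_eq_square)
  finally show ?thesis
    by (simp add: z_def \<alpha>_def \<tau>_def lens_factor_def v_def \<rho>_def power_mult_distrib)
qed

end


section \<open>A local form of Becker's univalence criterion\<close>

text \<open>
  The extension \<open>\<Phi>(w) = F(R w) + (w - R w) F'(R w)\<close> replaces \<open>F\<close> outside the lens by its tangent at
  the reflected point. With \<open>T(z) = F(z) + (a - z) F'(z)\<close> one has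
  \<open>\<Phi>(a) - \<Phi>(b) = (a - b) F'(R b) + T(R a) - T(R b)\<close> and \<open>T'(z) = (a - z) F''(z)\<close>. So \<open>\<Phi>(a) = \<Phi>(b)\<close>
  forces the mean value inequality recorded as \<open>collision\<close>, which is contradictory both for \<open>a\<close>, \<open>b\<close>
  near a common point and for \<open>a\<close>, \<open>b\<close> near infinity.
\<close>
lemma inj_on_lens:
  assumes p: "cmod p < 1"
    and U: "open U" "lens p \<subseteq> U" and hol: "F holomorphic_on U"
    and bound: "\<And>z. z \<in> lens p \<Longrightarrow>
      (1 - (cmod z)\<^sup>2) * cmod (deriv (deriv F) z) < cmod (deriv F z)"
  shows "inj_on F (lens p)"
proof -
  let ?R = "lens_fold p" and ?\<mu> = "lens_factor p" and ?F1 = "deriv F" and ?F2 = "deriv (deriv F)"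
  define \<Phi> where "\<Phi> w = F (?R w) + (w - ?R w) * ?F1 (?R w)" for w
  have RK: "?R w \<in> lens p" for w by (rule lens_fold_in_lens[OF p])
  have K: "compact (lens p)" "convex (lens p)" "lens p \<noteq> {}"
    using RK[of 0] by (blast intro: compact_Int convex_Int compact_cball convex_cball)+
  have F1: "?F1 holomorphic_on U" and F2: "?F2 holomorphic_on U"
    using hol U by (auto intro: holomorphic_deriv)
  note dF = holomorphic_derivI[OF hol U(1)] and dF1 = holomorphic_derivI[OF F1 U(1)]
  have contK: "continuous_on (lens p) F" "continuous_on (lens p) ?F1" "continuous_on (lens p) ?F2"
    using hol F1 F2 U by (auto intro: holomorphic_on_imp_continuous_on continuous_on_subset)
  have nz: "?F1 z \<noteq> 0" if "z \<in> lens p" for z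
  proof -
    have "0 \<le> (1 - (cmod z)\<^sup>2) * cmod (?F2 z)"
      using that by (intro mult_nonneg_nonneg) (auto simp: power_le_one)
    thus ?thesis using bound[OF that] by auto
  qed
  have contR: "continuous_on UNIV ?R" by (rule continuous_on_lens_fold[OF p])
  have cont: "continuous_on UNIV \<Phi>"
    unfolding \<Phi>_def
    by (intro continuous_intros contR continuous_on_compose2[OF contK(1) contR]
        continuous_on_compose2[OF contK(2) contR]) (use RK in blast)+

  have collision: "\<exists>\<xi>\<in>closed_segment (?R a) (?R b).
      cmod (?F1 (?R b)) \<le> cmod (a - \<xi>) * cmod (?F2 \<xi>) * (?\<mu> a * ?\<mu> b)"
    if ne: "a \<noteq> b" and eq: "\<Phi> a = \<Phi> b" for a b
  proof -
    let ?S = "closed_segment (?R a) (?R b)"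
    have S: "?S \<subseteq> lens p" using RK K by (intro closed_segment_subset) auto
    have "continuous_on ?S (\<lambda>\<xi>. cmod (a - \<xi>) * cmod (?F2 \<xi>))"
      by (intro continuous_intros continuous_on_subset[OF contK(3) S])
    then obtain \<xi> where \<xi>: "\<xi> \<in> ?S"
      "\<And>y. y \<in> ?S \<Longrightarrow> cmod (a - y) * cmod (?F2 y) \<le> cmod (a - \<xi>) * cmod (?F2 \<xi>)"
      using continuous_attains_sup[of ?S "\<lambda>\<xi>. cmod (a - \<xi>) * cmod (?F2 \<xi>)"] by auto
    define T where "T z = F z + (a - z) * ?F1 z" for z
    have dT: "(T has_field_derivative (a - z) * ?F2 z) (at z within ?S)" if "z \<in> ?S" for z
    proof -
      have "z \<in> U" using that S U by auto
      have "(T has_field_derivative ?F1 z + ((0 - 1) * ?F1 z + ?F2 z * (a - z))) (at z within ?S)"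
        unfolding T_def
        by (intro DERIV_add DERIV_mult DERIV_diff DERIV_const DERIV_ident
            has_field_derivative_at_within[OF dF] has_field_derivative_at_within[OF dF1] \<open>z \<in> U\<close>)
      thus ?thesis by (simp add: mult.commute)
    qed
    have "cmod (T (?R a) - T (?R b)) \<le> cmod (a - \<xi>) * cmod (?F2 \<xi>) * cmod (?R a - ?R b)"
      by (rule field_differentiable_bound[OF convex_closed_segment dT])
         (use \<xi>(2) in \<open>auto simp: norm_mult\<close>)
    also have "\<dots> \<le> cmod (a - \<xi>) * cmod (?F2 \<xi>) * (?\<mu> a * ?\<mu> b * cmod (a - b))"
      by (intro mult_left_mono lens_fold_contraction[OF p]) auto
    also have "T (?R a) - T (?R b) = \<Phi> a - \<Phi> b - (a - b) * ?F1 (?R b)"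
      by (simp add: T_def \<Phi>_def algebra_simps)
    also have "\<dots> = - ((a - b) * ?F1 (?R b))" using eq by simp
    finally have "cmod (?F1 (?R b)) * cmod (a - b)
        \<le> cmod (a - \<xi>) * cmod (?F2 \<xi>) * (?\<mu> a * ?\<mu> b) * cmod (a - b)"
      by (simp only: norm_minus_cancel norm_mult mult_ac)
    thus ?thesis using ne \<xi>(1) by (auto intro!: bexI[of _ \<xi>])
  qed

  \<comment> \<open>Colliding pairs that tend to \<open>w\<close> would give, in the limit of \<open>collision\<close>, the reverse of the
    hypothesis at the point \<open>R w\<close>.\<close>
  have loc: "\<exists>e>0. inj_on \<Phi> (ball w e)" for w
  proof (rule ccontr)
    assume contra: "\<not> ?thesis"
    have "\<exists>a b. a \<in> ball w (1 / Suc n) \<and> b \<in> ball w (1 / Suc n) \<and> a \<noteq> b \<and> \<Phi> a = \<Phi> b" for n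
    proof -
      have "\<not> inj_on \<Phi> (ball w (1 / Suc n))" using contra by (metis of_nat_0_less_iff zero_less_Suc zero_less_divide_1_iff)
      thus ?thesis unfolding inj_on_def by blast
    qed
    then obtain a b where ab: "\<And>n. a n \<in> ball w (1 / Suc n)" "\<And>n. b n \<in> ball w (1 / Suc n)"
      "\<And>n::nat. a n \<noteq> b n" "\<And>n. \<Phi> (a n) = \<Phi> (b n)"
      by metis
    obtain \<xi> where \<xi>: "\<And>n. \<xi> n \<in> closed_segment (?R (a n)) (?R (b n))"
      "\<And>n. cmod (?F1 (?R (b n))) \<le> cmod (a n - \<xi> n) * cmod (?F2 (\<xi> n)) * (?\<mu> (a n) * ?\<mu> (b n))"
      using collision[OF ab(3,4)] by metis
    have inv: "(\<lambda>n. 1 / real (Suc n)) \<longlonglongrightarrow> 0"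
      using LIMSEQ_inverse_real_of_nat by (simp add: inverse_eq_divide)
    have near: "c \<longlonglongrightarrow> w" if "\<And>n. c n \<in> ball w (1 / Suc n)" for c
    proof -
      have "norm (dist (c n) w) \<le> 1 / real (Suc n)" for n
        using that[of n] unfolding mem_ball dist_commute[of w] real_norm_def abs_of_nonneg[OF zero_le_dist]
        by (rule less_imp_le)
      hence "\<forall>\<^sub>F n in sequentially. norm (dist (c n) w) \<le> 1 / real (Suc n)"
        by (rule always_eventually[OF allI])
      hence "(\<lambda>n. dist (c n) w) \<longlonglongrightarrow> 0" by (rule Lim_null_comparison[OF _ inv])
      thus ?thesis by (rule iffD2[OF tendsto_dist_iff])
    qed
    have la: "a \<longlonglongrightarrow> w" and lb: "b \<longlonglongrightarrow> w" using near ab by auto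
    have R: "(\<lambda>n. ?R (c n)) \<longlonglongrightarrow> ?R w" and M: "(\<lambda>n. ?\<mu> (c n)) \<longlonglongrightarrow> ?\<mu> w"
      if "c \<longlonglongrightarrow> w" for c
      using continuous_on_tendsto_compose[OF contR that]
        continuous_on_tendsto_compose[OF continuous_on_lens_factor[OF p, of UNIV] that] by auto
    have \<xi>R: "\<xi> \<longlonglongrightarrow> ?R w"
    proof -
      have "norm (\<xi> n - ?R (b n)) \<le> dist (?R (a n)) (?R (b n))" for n
        using segment_bound(2)[OF \<xi>(1)[of n]] by (simp add: dist_norm norm_minus_commute)
      hence "\<forall>\<^sub>F n in sequentially. norm (\<xi> n - ?R (b n)) \<le> dist (?R (a n)) (?R (b n))"
        by (rule always_eventually[OF allI])
      moreover have "(\<lambda>n. dist (?R (a n)) (?R (b n))) \<longlonglongrightarrow> 0"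
        using tendsto_dist[OF R[OF la] R[OF lb]] by simp
      ultimately have "(\<lambda>n. \<xi> n - ?R (b n)) \<longlonglongrightarrow> 0" by (rule Lim_null_comparison)
      from tendsto_add[OF this R[OF lb]] show ?thesis by simp
    qed
    have "\<xi> n \<in> lens p" for n by (rule subsetD[OF closed_segment_subset[OF RK RK K(2)] \<xi>(1)])
    hence "(\<lambda>n. ?F2 (\<xi> n)) \<longlonglongrightarrow> ?F2 (?R w)"
      using continuous_on_tendsto_compose[OF contK(3) \<xi>R] RK by simp
    moreover have "(\<lambda>n. ?F1 (?R (b n))) \<longlonglongrightarrow> ?F1 (?R w)"
      using continuous_on_tendsto_compose[OF contK(2) R[OF lb]] RK by simp
    ultimately have "cmod (?F1 (?R w)) \<le> cmod (w - ?R w) * cmod (?F2 (?R w)) * (?\<mu> w * ?\<mu> w)"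
      using \<xi>(2) by (intro LIMSEQ_le[of "\<lambda>n. cmod (?F1 (?R (b n)))"
            _ "\<lambda>n. cmod (a n - \<xi> n) * cmod (?F2 (\<xi> n)) * (?\<mu> (a n) * ?\<mu> (b n))"]
          tendsto_intros la \<xi>R M[OF la] M[OF lb]) auto
    also have "\<dots> = cmod (w - ?R w) * (?\<mu> w)\<^sup>2 * cmod (?F2 (?R w))"
      by (simp add: power2_eq_square)
    also have "\<dots> \<le> (1 - (cmod (?R w))\<^sup>2) * cmod (?F2 (?R w))"
      by (intro mult_right_mono lens_fold_displacement[OF p]) auto
    also have "\<dots> < cmod (?F1 (?R w))" by (rule bound[OF RK])
    finally show False by simp
  qed

  obtain z0 where z0: "z0 \<in> lens p" "\<And>z. z \<in> lens p \<Longrightarrow> cmod (?F1 z0) \<le> cmod (?F1 z)"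
    using continuous_attains_inf[OF K(1,3) continuous_on_norm[OF contK(2)]] by blast
  define m where "m = cmod (?F1 z0)"
  have m: "m > 0" "\<And>z. z \<in> lens p \<Longrightarrow> m \<le> cmod (?F1 z)" using z0 nz by (auto simp: m_def)
  have bdd: "\<exists>B>0. \<forall>z\<in>lens p. cmod (G z) \<le> B" if "continuous_on (lens p) G" for G :: "complex \<Rightarrow> complex"
    using compact_imp_bounded[OF compact_continuous_image[OF that K(1)]]
    by (auto simp: bounded_pos)
  obtain M where M: "M > 0" "\<And>z. z \<in> lens p \<Longrightarrow> cmod (?F2 z) \<le> M"
    using bdd[OF contK(3)] by blast
  have "continuous_on (lens p) (\<lambda>z. F z - z * ?F1 z)" by (intro continuous_intros contK)
  from bdd[OF this] obtain C where C: "\<And>z. z \<in> lens p \<Longrightarrow> cmod (F z - z * ?F1 z) \<le> C" by blast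

  have "bounded {w. cmod (\<Phi> w) \<le> B}" for B
  proof -
    have "cmod w \<le> (B + C) / m" if "cmod (\<Phi> w) \<le> B" for w
    proof -
      have "cmod w * m \<le> cmod (w * ?F1 (?R w))"
        using m(2)[OF RK] by (simp add: norm_mult mult_left_mono)
      also have "w * ?F1 (?R w) = \<Phi> w - (F (?R w) - ?R w * ?F1 (?R w))"
        by (simp add: \<Phi>_def algebra_simps)
      also have "cmod \<dots> \<le> B + C" using that C[OF RK] norm_triangle_ineq4 by (meson add_mono order_trans)
      finally show ?thesis using m by (simp add: pos_le_divide_eq)
    qed
    thus ?thesis by (auto simp: bounded_iff)
  qed
  \<comment> \<open>Where \<open>|a| > 1\<close>, the factor \<open>\<mu> a\<close> in \<open>collision\<close> compensates \<open>|a - \<xi>| \<le> 2|a|\<close>, so that the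
    bound is at most \<open>2 M \<mu> b\<close>. Since \<open>\<mu> b \<le> 1/|b|\<close>, this is below the
    minimum \<open>m\<close> of \<open>|F'|\<close> on the lens for large \<open>b\<close>.\<close>
  moreover have "inj_on \<Phi> (- cball 0 (max 1 (2 * M / m)))"
  proof (rule inj_onI, rule ccontr)
    fix a b :: complex
    assume ab: "a \<in> - cball 0 (max 1 (2 * M / m))" "b \<in> - cball 0 (max 1 (2 * M / m))"
      and eq: "\<Phi> a = \<Phi> b" "a \<noteq> b"
    obtain \<xi> where \<xi>: "\<xi> \<in> closed_segment (?R a) (?R b)"
      "cmod (?F1 (?R b)) \<le> cmod (a - \<xi>) * cmod (?F2 \<xi>) * (?\<mu> a * ?\<mu> b)"
      using collision eq by blast
    have \<xi>K: "\<xi> \<in> lens p" by (rule subsetD[OF closed_segment_subset[OF RK RK K(2)] \<xi>(1)])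
    have "cmod (a - \<xi>) \<le> cmod a + cmod \<xi>" by (rule norm_triangle_ineq4)
    also have "\<dots> \<le> 2 * cmod a" using ab \<xi>K by auto
    finally have far: "cmod (a - \<xi>) \<le> 2 * cmod a" .
    have "m \<le> cmod (a - \<xi>) * cmod (?F2 \<xi>) * (?\<mu> a * ?\<mu> b)" using m(2)[OF RK] \<xi>(2) by (rule order_trans)
    also have "\<dots> \<le> (2 * cmod a) * M * (?\<mu> a * ?\<mu> b)"
      using far M \<xi>K lens_factor_nonneg[OF p] by (intro mult_right_mono mult_mono) auto
    also have "\<dots> = 2 * M * (?\<mu> a * cmod a) * ?\<mu> b" by simp
    also have "\<dots> \<le> 2 * M * 1 * ?\<mu> b"
      using M lens_factor_nonneg[OF p] lens_factor_le[OF p, of a] by (intro mult_right_mono mult_left_mono) auto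
    finally have "m \<le> 2 * M * ?\<mu> b" by simp
    hence "m * cmod b \<le> 2 * M * (?\<mu> b * cmod b)"
      by (metis mult.assoc mult_right_mono norm_ge_zero)
    also have "\<dots> \<le> 2 * M * 1" using M lens_factor_le[OF p] by (intro mult_left_mono) auto
    finally have "cmod b \<le> 2 * M / m" using m by (simp add: field_simps)
    thus False using ab by auto
  qed
  ultimately have "inj \<Phi>" by (rule proper_locally_injective_imp_inj[OF cont loc])
  moreover have "\<Phi> z = F z" if "z \<in> lens p" for z
    using lens_fold_id[OF p that] by (simp add: \<Phi>_def)
  ultimately show ?thesis using inj_on_cong[of "lens p" \<Phi> F] inj_on_subset[of \<Phi> UNIV] by simp
qed


text \<open>
  The lens reaches the unit circle, where nothing is known about \<open>F\<close>. The dilated map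
  \<open>z \<mapsto> F(r z)\<close> is holomorphic across it and satisfies the same inequality as long as \<open>r z\<close> stays in
  the annulus; two given points at which \<open>F\<close> takes the same value lie in the dilate of the region
  by \<open>r\<close> once \<open>r\<close> is close to 1.
\<close>
lemma inj_on_disk_inter_ball:
  assumes hol: "F holomorphic_on unit_disk"
    and bound: "\<And>z. r0 < cmod z \<Longrightarrow> cmod z < 1 \<Longrightarrow>
      (1 - (cmod z)\<^sup>2) * cmod (deriv (deriv F) z) < cmod (deriv F z)"
    and p: "cmod p < 1" "r0 < cmod p - (1 - (cmod p)\<^sup>2)"
  shows "inj_on F (unit_disk \<inter> ball p (1 - (cmod p)\<^sup>2))" (is "inj_on F ?V")
proof (rule inj_onI)
  fix x y assume x: "x \<in> ?V" and y: "y \<in> ?V" and eq: "F x = F y"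
  have in_V: "\<forall>\<^sub>F r in at_left 1. w / complex_of_real r \<in> ?V" if "w \<in> ?V" for w
  proof -
    have "((\<lambda>r. w / complex_of_real r) \<longlongrightarrow> w / complex_of_real 1) (at_left (1::real))"
      by (intro tendsto_intros) auto
    moreover have "open ?V" by (intro open_Int open_ball)
    ultimately show ?thesis using that by (intro topological_tendstoD) simp_all
  qed
  have "((\<lambda>r. r * (cmod p - (1 - (cmod p)\<^sup>2))) \<longlongrightarrow> 1 * (cmod p - (1 - (cmod p)\<^sup>2))) (at_left (1::real))"
    by (intro tendsto_intros)
  hence "\<forall>\<^sub>F r in at_left 1. r0 < r * (cmod p - (1 - (cmod p)\<^sup>2))"
    using p(2) by (intro order_tendstoD(1)) auto
  moreover have "\<forall>\<^sub>F r in at_left (1::real). r \<in> {0<..<1}"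
    by (rule eventually_at_left_real) simp
  ultimately have "\<forall>\<^sub>F r in at_left 1. r0 < r * (cmod p - (1 - (cmod p)\<^sup>2)) \<and> r \<in> {0<..<1} \<and>
      x / of_real r \<in> ?V \<and> y / of_real r \<in> ?V"
    using in_V[OF x] in_V[OF y] by eventually_elim simp
  then obtain r where r: "r0 < r * (cmod p - (1 - (cmod p)\<^sup>2))" "0 < r" "r < 1"
    "x / of_real r \<in> ?V" "y / of_real r \<in> ?V"
    using eventually_happens'[OF trivial_limit_at_left_real] by fastforce
  define G where "G z = F (of_real r * z)" for z
  have scale: "of_real r * z \<in> unit_disk" if "z \<in> ball 0 (1 / r)" for z :: complex
    using that r by (simp add: norm_mult pos_less_divide_eq mult.commute)
  have "inj_on G (lens p)"
  proof (rule inj_on_lens[OF p(1) open_ball[of 0 "1 / r"]])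
    have "1 < 1 / r" using r by simp
    thus "lens p \<subseteq> ball 0 (1 / r)" by auto
    show "G holomorphic_on ball 0 (1 / r)"
      unfolding G_def
      by (rule holomorphic_on_compose_gen[OF _ hol, unfolded o_def])
         (use scale in \<open>auto intro!: holomorphic_intros\<close>)
    fix z assume z: "z \<in> lens p"
    have zU: "z \<in> ball 0 (1 / r)" using z \<open>1 < 1 / r\<close> by auto
    have der: "(deriv ^^ n) G z = of_real r ^ n * (deriv ^^ n) F (of_real r * z)" for n
      unfolding G_def by (rule higher_deriv_compose_linear[OF hol open_ball open_ball zU scale])
    have d1: "deriv G z = of_real r * deriv F (of_real r * z)" using der[of 1] by simp
    have d2: "deriv (deriv G) z = (of_real r)\<^sup>2 * deriv (deriv F) (of_real r * z)"
      using der[of 2] by (simp add: numeral_2_eq_2)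
    have z1: "cmod z \<le> 1" and zp: "cmod p - cmod z \<le> 1 - (cmod p)\<^sup>2"
      using z norm_triangle_ineq2[of p z] by (auto simp: dist_norm)
    have "r * (cmod p - (1 - (cmod p)\<^sup>2)) \<le> r * cmod z" using zp r by (intro mult_left_mono) auto
    hence "r0 < r * cmod z" using r(1) by linarith
    hence ann: "r0 < cmod (of_real r * z)" using r(2) by (simp add: norm_mult)
    have lt1: "cmod (of_real r * z) < 1" using scale[OF zU] by simp
    have "(1 - (cmod z)\<^sup>2) * r \<le> (1 - (cmod z)\<^sup>2) * 1"
      using r z1 by (intro mult_left_mono) (auto simp: power_le_one)
    also have "\<dots> \<le> 1 - (cmod (of_real r * z))\<^sup>2"
      using r by (simp add: norm_mult power_mult_distrib mult_left_le_one_le power_le_one)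
    finally have "(1 - (cmod z)\<^sup>2) * r * cmod (deriv (deriv F) (of_real r * z))
        \<le> (1 - (cmod (of_real r * z))\<^sup>2) * cmod (deriv (deriv F) (of_real r * z))"
      by (rule mult_right_mono) simp
    also have "\<dots> < cmod (deriv F (of_real r * z))" by (rule bound[OF ann lt1])
    finally have "r * ((1 - (cmod z)\<^sup>2) * r * cmod (deriv (deriv F) (of_real r * z)))
        < r * cmod (deriv F (of_real r * z))"
      using r by simp
    thus "(1 - (cmod z)\<^sup>2) * cmod (deriv (deriv G) z) < cmod (deriv G z)"
      using r by (simp add: d1 d2 norm_mult norm_power power2_eq_square algebra_simps)
  qed
  moreover have "G (x / of_real r) = G (y / of_real r)" using eq r by (simp add: G_def)
  moreover have "?V \<subseteq> lens p" by auto
  ultimately have "x / of_real r = y / of_real r" using r by (meson inj_onD subsetD)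
  thus "x = y" using r by simp
qed

section \<open>The pencil of holomorphic functions attached to a harmonic mapping\<close>

lemma pencil_derivatives:
  assumes hol: "h holomorphic_on unit_disk" "g holomorphic_on unit_disk" and z: "z \<in> unit_disk"
  shows "deriv (\<lambda>z. h z + a * g z) z = deriv h z + a * deriv g z"
    "deriv (deriv (\<lambda>z. h z + a * g z)) z = deriv (deriv h) z + a * deriv (deriv g) z"
proof -
  have d: "deriv (\<lambda>z. H z + a * G z) y = deriv H y + a * deriv G y"
    if "H holomorphic_on unit_disk" "G holomorphic_on unit_disk" "y \<in> unit_disk" for H G y
    using that by (intro DERIV_imp_deriv DERIV_add DERIV_cmult holomorphic_derivI[OF _ open_ball])
  show "deriv (\<lambda>z. h z + a * g z) z = deriv h z + a * deriv g z" by (rule d[OF hol z])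
  have "deriv (deriv (\<lambda>z. h z + a * g z)) z = deriv (\<lambda>z. deriv h z + a * deriv g z) z"
    by (rule complex_derivative_transform_within_open[OF _ _ open_ball z])
       (use hol d[OF hol] in \<open>auto intro!: holomorphic_intros holomorphic_deriv\<close>)
  also have "\<dots> = deriv (deriv h) z + a * deriv (deriv g) z"
    by (rule d[OF _ _ z]) (use hol in \<open>auto intro!: holomorphic_deriv\<close>)
  finally show "deriv (deriv (\<lambda>z. h z + a * g z)) z = deriv (deriv h) z + a * deriv (deriv g) z" .
qed

text \<open>
  From \<open>F' = h' (1 + a\<omega>)\<close> one finds
  \<open>F''/F' = P_H + \<omega>'/(1 - |\<omega>|\<^sup>2) \<cdot> (cnj \<omega> + a)/(1 + a\<omega>)\<close>, and the last quotient is of modulus at most 1,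
  because it is the image of \<open>a\<close> under an automorphism of the unit disk.
\<close>
lemma pencil_pre_Schwarzian_bound:
  assumes hol: "h holomorphic_on unit_disk" "g holomorphic_on unit_disk" and z: "z \<in> unit_disk"
    and jac: "jacobian h g z > 0" and a: "cmod a \<le> 1"
  defines "F \<equiv> \<lambda>z. h z + a * g z" and "\<omega> \<equiv> dilatation h g"
  shows "deriv F z \<noteq> 0"
    "cmod (deriv (deriv F) z) \<le> cmod (deriv F z) *
      (cmod (harmonic_pre_Schwarzian h g z) + cmod (deriv \<omega> z) / (1 - (cmod (\<omega> z))\<^sup>2))"
proof -
  define P where "P = harmonic_pre_Schwarzian h g z"
  define s where "s = 1 - (cmod (\<omega> z))\<^sup>2"
  have lt: "cmod (deriv g z) < cmod (deriv h z)"
    using jac by (simp add: jacobian_def power_less_imp_less_base)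
  hence h0: "deriv h z \<noteq> 0" by auto
  have \<omega>1: "cmod (\<omega> z) < 1"
    using lt h0 by (simp add: \<omega>_def dilatation_def norm_divide)
  hence s: "s > 0" by (simp add: s_def abs_square_less_1)
  have sc: "of_real s = 1 - \<omega> z * cnj (\<omega> z)"
    by (simp only: s_def of_real_diff of_real_1 complex_norm_square)
  have g1: "deriv g z = \<omega> z * deriv h z" using h0 by (simp add: \<omega>_def dilatation_def)
  have "(\<omega> has_field_derivative
      (deriv (deriv g) z * deriv h z - deriv g z * deriv (deriv h) z) / (deriv h z * deriv h z)) (at z)"
    unfolding \<omega>_def dilatation_def
    by (intro DERIV_divide holomorphic_derivI[OF _ open_ball z] holomorphic_deriv hol h0) auto
  hence \<omega>': "deriv \<omega> z = (deriv (deriv g) z * deriv h z - deriv g z * deriv (deriv h) z) / (deriv h z * deriv h z)"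
    by (rule DERIV_imp_deriv)
  hence g2: "deriv (deriv g) z = deriv \<omega> z * deriv h z + \<omega> z * deriv (deriv h) z"
  proof -
    have "deriv h z * deriv (deriv g) z = deriv h z * (deriv \<omega> z * deriv h z + \<omega> z * deriv (deriv h) z)"
      using h0 by (simp add: \<omega>' g1 field_simps)
    thus ?thesis using h0 by simp
  qed
  have F1: "deriv F z = deriv h z * (1 + a * \<omega> z)"
    using pencil_derivatives(1)[OF hol z] by (simp add: F_def g1 algebra_simps)
  have "cmod (a * \<omega> z) < 1"
    using a \<omega>1 by (simp add: norm_mult) (meson le_less_trans mult_left_le_one_le norm_ge_zero)
  hence "1 + a * \<omega> z \<noteq> 0" by (metis add_eq_0_iff less_irrefl norm_minus_cancel norm_one)
  thus "deriv F z \<noteq> 0" using h0 F1 by simp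
  have h2: "deriv (deriv h) z = deriv h z * (P + cnj (\<omega> z) * deriv \<omega> z / of_real s)"
    using h0 by (simp add: P_def harmonic_pre_Schwarzian_def pre_Schwarzian_def \<omega>_def s_def)
  have "deriv (deriv F) z = deriv (deriv h) z * (1 + a * \<omega> z) + a * deriv \<omega> z * deriv h z"
    using pencil_derivatives(2)[OF hol z] by (simp add: F_def g2 algebra_simps)
  also have "\<dots> = deriv h z * ((1 + a * \<omega> z) * P +
      deriv \<omega> z * ((1 + a * \<omega> z) * cnj (\<omega> z) + a * of_real s) / of_real s)"
    using s by (simp add: h2 field_simps)
  also have "(1 + a * \<omega> z) * cnj (\<omega> z) + a * of_real s = cnj (\<omega> z) + a"
    by (simp add: sc algebra_simps)
  finally have F2: "deriv (deriv F) z =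
    deriv h z * ((1 + a * \<omega> z) * P + deriv \<omega> z * (cnj (\<omega> z) + a) / of_real s)" .
  have "(cmod (1 + a * \<omega> z))\<^sup>2 - (cmod (cnj (\<omega> z) + a))\<^sup>2 = (1 - (cmod a)\<^sup>2) * s"
    unfolding s_def cmod_power2 by (simp add: power2_eq_square algebra_simps)
  moreover have "(1 - (cmod a)\<^sup>2) * s \<ge> 0" using a s by (simp add: power_le_one)
  ultimately have "(cmod (cnj (\<omega> z) + a))\<^sup>2 \<le> (cmod (1 + a * \<omega> z))\<^sup>2" by linarith
  hence "cmod (cnj (\<omega> z) + a) \<le> cmod (1 + a * \<omega> z)"
    by (rule power2_le_imp_le) simp
  hence "cmod (deriv \<omega> z * (cnj (\<omega> z) + a) / of_real s) \<le> cmod (deriv \<omega> z) * cmod (1 + a * \<omega> z) / s"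
    using s by (simp add: norm_mult norm_divide divide_right_mono mult_left_mono)
  hence "cmod (deriv (deriv F) z) \<le> cmod (deriv h z) *
      (cmod (1 + a * \<omega> z) * cmod P + cmod (deriv \<omega> z) * cmod (1 + a * \<omega> z) / s)"
    unfolding F2 norm_mult[of "deriv h z"]
    by (intro mult_left_mono norm_triangle_le add_mono) (auto simp: norm_mult)
  also have "\<dots> = cmod (deriv F z) * (cmod P + cmod (deriv \<omega> z) / s)"
    unfolding F1 norm_mult by (simp add: distrib_left mult_ac)
  finally show "cmod (deriv (deriv F) z) \<le> cmod (deriv F z) *
      (cmod (harmonic_pre_Schwarzian h g z) + cmod (deriv \<omega> z) / (1 - (cmod (\<omega> z))\<^sup>2))"
    by (simp add: P_def s_def)
qed

section \<open>Injectivity and valence of the harmonic mapping\<close>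

text \<open>
  If \<open>d = g x - g y\<close>, then a coincidence of \<open>h + cnj g\<close> at \<open>x\<close> and \<open>y\<close> means \<open>h x - h y = - cnj d\<close>,
  and \<open>cnj d = a d\<close> for some \<open>a\<close> of modulus at most 1.
\<close>
lemma harmonic_inj_on:
  assumes "\<And>a. cmod a \<le> 1 \<Longrightarrow> inj_on (\<lambda>z. h z + a * g z) S"
  shows "inj_on (\<lambda>z. h z + cnj (g z)) S"
proof (rule inj_onI)
  fix x y assume xy: "x \<in> S" "y \<in> S" "h x + cnj (g x) = h y + cnj (g y)"
  define d where "d = g x - g y"
  \<comment> \<open>For \<open>d = 0\<close> this is \<open>a = 0\<close>, and \<open>cnj d = a d\<close> still holds.\<close>
  define a where "a = cnj d / d"
  have "cmod a \<le> 1" by (simp add: a_def norm_divide)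
  have "h x - h y = - cnj d" using xy(3) by (simp add: d_def algebra_simps)
  moreover have "a * d = cnj d" by (simp add: a_def)
  ultimately have "(h x - h y) + a * d = 0" by simp
  hence "h x + a * g x = h y + a * g y" by (simp add: d_def algebra_simps)
  thus "x = y" using assms[OF \<open>cmod a \<le> 1\<close>] xy by (auto dest: inj_onD)
qed

lemma fibre_card_le_cover:
  assumes "finite \<C>" "A \<subseteq> \<Union>\<C>" "\<And>V. V \<in> \<C> \<Longrightarrow> inj_on f (V \<inter> A)" "\<And>x. x \<in> A \<Longrightarrow> f x = w"
  shows "finite A" "card A \<le> card \<C>"
proof -
  have "\<forall>x\<in>A. \<exists>V\<in>\<C>. x \<in> V" using assms(2) by blast
  then obtain V where V: "\<And>x. x \<in> A \<Longrightarrow> V x \<in> \<C> \<and> x \<in> V x"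
    by (auto simp: Bex_def dest!: bchoice)
  have inj: "inj_on V A"
  proof (rule inj_onI)
    fix x y assume xy: "x \<in> A" "y \<in> A" "V x = V y"
    show "x = y"
      by (rule inj_onD[OF assms(3)[of "V x"]]) (use xy V assms(4) in auto)
  qed
  have sub: "V ` A \<subseteq> \<C>" using V by blast
  show "finite A" using inj sub assms(1) by (rule inj_on_finite)
  show "card A \<le> card \<C>" using inj sub assms(1) by (rule card_inj_on_le)
qed

theorem theorem1:
  fixes f h g \<omega> :: "complex \<Rightarrow> complex"
  assumes "orientation_preserving_harmonic_mapping f h g"
    and "\<omega> = dilatation h g"
    and "Limsup to_unit_circle
           (\<lambda>z. ereal (cmod (harmonic_pre_Schwarzian h g z) * (1 - (cmod z)\<^sup>2) +
                       cmod (deriv \<omega> z) * (1 - (cmod z)\<^sup>2) / (1 - (cmod (\<omega> z))\<^sup>2))) < 1"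
  shows "\<exists>N::nat. N > 0 \<and> (\<forall>w. valence f h g w \<le> enat N)"
proof -
  have hol: "h holomorphic_on unit_disk" "g holomorphic_on unit_disk"
    and feq: "\<And>z. z \<in> unit_disk \<Longrightarrow> f z = h z + cnj (g z)"
    and lu: "locally_univalent_on f unit_disk"
    and jac: "\<And>z. z \<in> unit_disk \<Longrightarrow> jacobian h g z > 0"
    using assms(1) by (auto simp: orientation_preserving_harmonic_mapping_def canonical_rep_def)
  define E where "E z = cmod (harmonic_pre_Schwarzian h g z) * (1 - (cmod z)\<^sup>2) +
      cmod (deriv \<omega> z) * (1 - (cmod z)\<^sup>2) / (1 - (cmod (\<omega> z))\<^sup>2)" for z
  have "\<forall>\<^sub>F z in to_unit_circle. ereal (E z) < 1"
    using Limsup_lessD[OF assms(3)] by (simp add: E_def)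
  then obtain r0 where r0: "r0 < 1" "\<And>z. r0 < cmod z \<Longrightarrow> cmod z < 1 \<Longrightarrow> E z < 1"
    by (auto simp: eventually_filtercomap eventually_at_left[of 0])
  have bound: "(1 - (cmod z)\<^sup>2) * cmod (deriv (deriv (\<lambda>z. h z + a * g z)) z)
      < cmod (deriv (\<lambda>z. h z + a * g z) z)"
    if z: "r0 < cmod z" "cmod z < 1" and a: "cmod a \<le> 1" for z a
  proof -
    have zD: "z \<in> unit_disk" using z by simp
    note B = pencil_pre_Schwarzian_bound[OF hol zD jac[OF zD] a]
    have "(1 - (cmod z)\<^sup>2) * cmod (deriv (deriv (\<lambda>z. h z + a * g z)) z)
      \<le> (1 - (cmod z)\<^sup>2) * (cmod (deriv (\<lambda>z. h z + a * g z) z) *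
      (cmod (harmonic_pre_Schwarzian h g z) + cmod (deriv \<omega> z) / (1 - (cmod (\<omega> z))\<^sup>2)))"
      using B(2) z by (intro mult_left_mono) (auto simp: assms(2) power_le_one)
    also have "\<dots> = cmod (deriv (\<lambda>z. h z + a * g z) z) * E z"
      by (simp add: E_def algebra_simps)
    also have "\<dots> < cmod (deriv (\<lambda>z. h z + a * g z) z) * 1"
      using r0(2)[OF z] B(1) by (intro mult_strict_left_mono) auto
    finally show ?thesis by simp
  qed
  have cover: "\<exists>V. open V \<and> z \<in> V \<and> inj_on f (V \<inter> unit_disk)" if "z \<in> cball 0 1" for z
  proof (cases "cmod z < 1")
    case True
    hence "z \<in> unit_disk" by simp
    then obtain U where "open U" "z \<in> U" "U \<subseteq> unit_disk" "inj_on f U"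
      using lu unfolding locally_univalent_on_def by blast
    thus ?thesis by (metis inf.absorb_iff1)
  next
    case False
    hence z1: "cmod z = 1" using that by simp
    have "((\<lambda>c. c - (1 - c\<^sup>2)) \<longlongrightarrow> 1 - (1 - 1\<^sup>2)) (at_left (1::real))"
      by (intro tendsto_intros)
    hence "\<forall>\<^sub>F c in at_left (1::real). r0 < c - (1 - c\<^sup>2)"
      using r0(1) by (intro order_tendstoD(1)) auto
    moreover have "\<forall>\<^sub>F c in at_left (1::real). c \<in> {0<..<1}"
      by (rule eventually_at_left_real) simp
    ultimately have "\<forall>\<^sub>F c in at_left (1::real). r0 < c - (1 - c\<^sup>2) \<and> c \<in> {0<..<1}"
      by eventually_elim simp
    then obtain c where c: "r0 < c - (1 - c\<^sup>2)" "0 < c" "c < 1"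
      using eventually_happens'[OF trivial_limit_at_left_real] by fastforce
    \<comment> \<open>The disk about \<open>p\<close> reaches beyond the boundary point \<open>z\<close>, since \<open>1 - c < 1 - c\<^sup>2\<close>, and lies
      outside \<open>|z| \<le> r0\<close> for \<open>c\<close> close to 1.\<close>
    define p where "p = of_real c * z"
    have p: "cmod p = c" using c z1 by (simp add: p_def norm_mult)
    have "inj_on (\<lambda>z. h z + a * g z) (unit_disk \<inter> ball p (1 - (cmod p)\<^sup>2))" if "cmod a \<le> 1" for a
      using that c p by (intro inj_on_disk_inter_ball[where ?r0.0 = r0] bound)
        (auto intro!: holomorphic_intros hol)
    hence "inj_on (\<lambda>z. h z + cnj (g z)) (unit_disk \<inter> ball p (1 - (cmod p)\<^sup>2))"
      by (rule harmonic_inj_on)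
    hence "inj_on f (ball p (1 - (cmod p)\<^sup>2) \<inter> unit_disk)"
      by (subst inj_on_cong[where g = "\<lambda>z. h z + cnj (g z)"]) (auto simp: feq Int_commute)
    moreover have "z \<in> ball p (1 - (cmod p)\<^sup>2)"
    proof -
      have "p - z = of_real (c - 1) * z" by (simp add: p_def algebra_simps)
      hence "dist p z = cmod (of_real (c - 1))" using z1 by (simp only: dist_norm norm_mult mult_1_right)
      also have "\<dots> = 1 - c" using c by (simp only: norm_of_real)
      also have "\<dots> < 1 - c\<^sup>2" using c by (simp add: power2_eq_square)
      finally show ?thesis by (simp add: p)
    qed
    ultimately show ?thesis by (intro exI[of _ "ball p (1 - (cmod p)\<^sup>2)"]) auto
  qed
  define \<C> where "\<C> = {V. open V \<and> inj_on f (V \<inter> unit_disk)}"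
  have "cball 0 1 \<subseteq> \<Union>\<C>"
  proof
    fix z :: complex assume "z \<in> cball 0 1"
    from cover[OF this] show "z \<in> \<Union>\<C>" unfolding \<C>_def by blast
  qed
  moreover have "open V" if "V \<in> \<C>" for V using that by (simp add: \<C>_def)
  ultimately obtain \<D> where \<D>: "\<D> \<subseteq> \<C>" "finite \<D>" "cball 0 1 \<subseteq> \<Union>\<D>"
    by (meson compactE[OF compact_cball])
  have mult: "harmonic_multiplicity h g z = 1" if "z \<in> unit_disk" for z
  proof -
    have "deriv h z \<noteq> 0" using jac[OF that] by (auto simp: jacobian_def)
    thus ?thesis unfolding harmonic_multiplicity_def by (intro Least_equality) auto
  qed
  have "valence f h g w \<le> enat (Suc (card \<D>))" for w
  proof -
    define A where "A = {z \<in> unit_disk. f z = w}"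
    have inj: "inj_on f (V \<inter> A)" if "V \<in> \<D>" for V
    proof -
      have "inj_on f (V \<inter> unit_disk)" using that \<D>(1) by (auto simp: \<C>_def)
      moreover have "V \<inter> A \<subseteq> V \<inter> unit_disk" by (auto simp: A_def)
      ultimately show ?thesis by (rule inj_on_subset)
    qed
    have "A \<subseteq> cball 0 1" by (auto simp: A_def)
    hence "A \<subseteq> \<Union>\<D>" using \<D>(3) by (rule order_trans)
    from fibre_card_le_cover[OF \<D>(2) this inj] have "finite A" "card A \<le> card \<D>"
      by (auto simp: A_def)
    moreover have "(\<Sum>z\<in>A. harmonic_multiplicity h g z) = card A"
      using mult by (simp add: A_def)
    ultimately show ?thesis unfolding valence_def A_def[symmetric] Let_def by simp
  qed
  thus ?thesis by (intro exI[of _ "Suc (card \<D>)"]) auto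
qed

end
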